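(* Let $P(\partial_t,D_x)=\partial_t^m+\sum_{k=1}^m a_k(D_x)\partial_t^{m-k}$, where $m\ge1$ and $a_k(\xi)$, $1\le k\le m$, are polynomials on $\mathbb{R}^d$ of arbitrary degree. Assume that there are constants $C_0>0$, $\nu\ge1$ such that $$(\tau,\zeta)\in\mathbb{C}\times\mathbb{C}^d,\quad P(i\tau,\zeta)=0\ \Longrightarrow\ \operatorname{Im}\tau\ge -C_0(1+|\operatorname{Im}\zeta|)^\nu.$$ Then the symbol $\sigma(t,\xi)$ of the corresponding propagator $\sigma(t,D_x)$ satisfies, for some constant $C>0$ and with $s=1-1/\nu$, $$|\partial_\xi^\alpha\sigma(t,\xi)|\le C^{(t+1)|\alpha|+t}(\alpha!)^s\qquad\text{for all }\xi\in\mathbb{R}^d,\ t\ge0,\ \alpha\in\mathbb{N}^d.$$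
   Context: Here $t\in\mathbb{R}$, $x\in\mathbb{R}^d$, $D_{x_j}=\frac{1}{2\pi i}\partial_{x_j}$, and the polynomials $a_k$ may have complex coefficients and be non-homogeneous. $P(i\tau,\zeta)=(i\tau)^m+\sum_{k=1}^m a_k(\zeta)(i\tau)^{m-k}$ for $(\tau,\zeta)\in\mathbb{C}\times\mathbb{C}^d$. The symbol $\sigma(t,\xi)$ of the propagator is, for each $\xi$, the unique solution of $$\Big(\partial_t^m+\sum_{k=1}^m a_k(\xi)\partial_t^{m-k}\Big)\sigma(t,\xi)=\delta(t)$$ supported in $[0,+\infty)\times\mathbb{R}^d$; equivalently, for $t\ge0$, $\sigma(\cdot,\xi)$ is the solution of the homogeneous ODE with $\partial_t^k\sigma(0,\xi)=0$ for $0\le k\le m-2$ and $\partial_t^{m-1}\sigma(0,\xi)=1$ (values at $t=0$ taken from the right). The propagator is the Fourier multiplier $\sigma(t,D_x)f=\mathcal{F}^{-1}(\sigma(t,\cdot)\mathcal{F}f)=E(t,\cdot)*f$, with $E(t,\cdot)=\mathcal{F}^{-1}\sigma(t,\cdot)$ and $\mathcal{F}f(\xi)=\int f(x)e^{-2\pi ix\cdot\xi}\,dx$. *)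

theory Defs
  imports "HOL-Analysis.Analysis" "HOL-Library.Poly_Mapping"
begin

text \<open>
  A complex polynomial in variables indexed by \<open>'n\<close> is a finitely supported map from
  exponent vectors to coefficients. The same coefficients give the polynomial function on
  \<open>complex ^ 'n\<close> and, through \<open>cvec\<close>, on \<open>real ^ 'n\<close>.
\<close>

type_synonym 'n cpoly = "('n \<Rightarrow> nat) \<Rightarrow>\<^sub>0 complex"

definition peval :: "'n::finite cpoly \<Rightarrow> complex ^ 'n \<Rightarrow> complex" where
  "peval p z = (\<Sum>\<beta>\<in>Poly_Mapping.keys p. Poly_Mapping.lookup p \<beta> * (\<Prod>j\<in>UNIV. (z $ j) ^ \<beta> j))"

definition cvec :: "real ^ 'n \<Rightarrow> complex ^ 'n" where
  "cvec \<xi> = (\<chi> j. complex_of_real (\<xi> $ j))"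

definition Im_vec :: "complex ^ 'n \<Rightarrow> real ^ 'n" where
  "Im_vec z = (\<chi> j. Im (z $ j))"

text \<open>
  \<open>char_symbol m a w z\<close> is \<open>P(w, z)\<close>, to be used with \<open>w = \<i> * \<tau>\<close>. Since \<open>D\<^sub>x\<close> is
  \<open>1/(2\<pi>\<i>)\<close> times the gradient and the Fourier transform has kernel
  \<open>exp (-2\<pi>\<i> x \<bullet> \<xi>)\<close>, the symbol of \<open>a\<^sub>k(D\<^sub>x)\<close> is \<open>a\<^sub>k(\<xi>)\<close>, without constants.
\<close>

definition char_symbol ::
    "nat \<Rightarrow> (nat \<Rightarrow> 'n::finite cpoly) \<Rightarrow> complex \<Rightarrow> complex ^ 'n \<Rightarrow> complex" where
  "char_symbol m a w z = w ^ m + (\<Sum>k=1..m. peval (a k) z * w ^ (m - k))"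

text \<open>
  For each \<open>\<xi>\<close>, \<open>\<sigma>(\<cdot>, \<xi>)\<close> vanishes for \<open>t < 0\<close> and on \<open>t \<ge> 0\<close> solves the homogeneous
  equation with initial data \<open>(0, \<dots>, 0, 1)\<close>; this is the solution supported in \<open>t \<ge> 0\<close>
  of the equation with right-hand side \<open>\<delta>(t)\<close>. Here \<open>u k\<close> is the \<open>k\<close>-th time derivative
  on \<open>[0, \<infinity>)\<close>, which at \<open>t = 0\<close> is the derivative from the right.
\<close>

definition propagator_symbol ::
    "nat \<Rightarrow> (nat \<Rightarrow> 'n::finite cpoly) \<Rightarrow> (real \<Rightarrow> real ^ 'n \<Rightarrow> complex) \<Rightarrow> bool" where
  "propagator_symbol m a \<sigma> \<longleftrightarrow>
     (\<forall>\<xi>. (\<forall>t<0. \<sigma> t \<xi> = 0) \<and>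
       (\<exists>u :: nat \<Rightarrow> real \<Rightarrow> complex.
          (\<forall>t\<ge>0. u 0 t = \<sigma> t \<xi>) \<and>
          (\<forall>k<m. \<forall>t\<ge>0. (u k has_vector_derivative u (Suc k) t) (at t within {0..})) \<and>
          (\<forall>t\<ge>0. u m t + (\<Sum>k=1..m. peval (a k) (cvec \<xi>) * u (m - k) t) = 0) \<and>
          (\<forall>k<m - 1. u k 0 = 0) \<and>
          u (m - 1) 0 = 1))"

definition partial_deriv ::
    "'n::finite \<Rightarrow> (real ^ 'n \<Rightarrow> complex) \<Rightarrow> real ^ 'n \<Rightarrow> complex" where
  "partial_deriv j f x = vector_derivative (\<lambda>h. f (x + h *\<^sub>R axis j 1)) (at 0)"

fun iter_partial ::
    "'n::finite list \<Rightarrow> (real ^ 'n \<Rightarrow> complex) \<Rightarrow> real ^ 'n \<Rightarrow> complex" where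
  "iter_partial [] f = f"
| "iter_partial (j # js) f = partial_deriv j (iter_partial js f)"

text \<open>All partial derivatives of all orders exist and are continuous.\<close>

definition smooth_fun :: "(real ^ 'n::finite \<Rightarrow> complex) \<Rightarrow> bool" where
  "smooth_fun f \<longleftrightarrow>
     (\<forall>js. continuous_on UNIV (iter_partial js f) \<and>
       (\<forall>j x. (\<lambda>h. iter_partial js f (x + h *\<^sub>R axis j 1)) differentiable (at 0)))"

text \<open>
  The derivative of multi-index \<open>\<alpha>\<close> differentiates \<open>\<alpha> j\<close> times in the direction \<open>j\<close>. The
  index type carries no order, so some order of differentiation is chosen; for a
  \<open>smooth_fun\<close> the result does not depend on it.
\<close>

definition multi_deriv ::
    "('n::finite \<Rightarrow> nat) \<Rightarrow> (real ^ 'n \<Rightarrow> complex) \<Rightarrow> real ^ 'n \<Rightarrow> complex" where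
  "multi_deriv \<alpha> = iter_partial (SOME js. \<forall>j. count_list js j = \<alpha> j)"

definition multi_abs :: "('n::finite \<Rightarrow> nat) \<Rightarrow> nat" where
  "multi_abs \<alpha> = (\<Sum>j\<in>UNIV. \<alpha> j)"

definition multi_fact :: "('n::finite \<Rightarrow> nat) \<Rightarrow> real" where
  "multi_fact \<alpha> = (\<Prod>j\<in>UNIV. fact (\<alpha> j))"

end

theory Submission
  imports
    Defs
    "HOL-Complex_Analysis.Cauchy_Integral_Formula"
    "HOL-Computational_Algebra.Fundamental_Theorem_Algebra"
begin

text \<open>
  The symbol extends to an entire function \<open>F t\<close> of \<open>\<zeta> \<in> \<complex>\<^sup>d\<close>, namely the power series in \<open>t\<close>
  whose Taylor coefficients are given by the linear recursion with coefficients \<open>a\<^sub>k(\<zeta>)\<close>.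
  Factoring \<open>P(\<partial>\<^sub>t, \<zeta>)\<close> into first-order operators and integrating one factor at a time gives
  \<open>|F t \<zeta>| \<le> exp ((\<Lambda> + 1) t)\<close> as soon as all roots have real part at most \<open>\<Lambda>\<close>; by assumption
  \<open>\<Lambda> = C\<^sub>0 (1 + |Im \<zeta>|)\<^sup>\<nu>\<close> will do. For \<open>N = |\<alpha>| > 0\<close>, applying the one-variable Cauchy estimate
  \<open>N\<close> times with radius \<open>r = N powr (1/\<nu> - 1)\<close> costs \<open>r\<^sup>-\<^sup>N = (N\<^sup>N)\<^sup>s\<close> and moves the argument at
  most \<open>N powr (1/\<nu>)\<close> off the real space, where \<open>\<Lambda>\<close> is \<open>O(N)\<close>. Finally
  \<open>N\<^sup>N \<le> exp (d N) \<alpha>!\<close>.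
\<close>

section \<open>Growth in time for constant-coefficient ODEs\<close>

text \<open>The term \<open>u i\<close> stands for the i-th derivative of \<open>u 0\<close>. Only
  \<open>deriv_chain\<close> imposes that relation, so factoring operators is pure algebra on
  sequences.\<close>

definition diff_op :: "complex poly \<Rightarrow> (nat \<Rightarrow> real \<Rightarrow> complex) \<Rightarrow> real \<Rightarrow> complex" where
  "diff_op p u t = (\<Sum>i\<le>degree p. coeff p i * u i t)"

definition deriv_chain :: "nat \<Rightarrow> (nat \<Rightarrow> real \<Rightarrow> complex) \<Rightarrow> bool" where
  "deriv_chain n u \<longleftrightarrow>
     (\<forall>k<n. \<forall>t\<ge>0. (u k has_vector_derivative u (Suc k) t) (at t within {0..}))"

text \<open>Passing from \<open>u k\<close> to \<open>u (Suc k)\<close> is differentiation in time,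
  so the factor \<open>[:- w, 1:]\<close> turns \<open>u\<close> into the sequence belonging to u' -
  w u, on which \<open>q\<close> then acts.\<close>

lemma diff_op_linear_factor:
  assumes "q \<noteq> 0"
  shows "diff_op ([:- w, 1:] * q) u t = diff_op q (\<lambda>k t. u (Suc k) t - w * u k t) t"
proof -
  define n where "n = degree q"
  have deg: "degree ([:- w, 1:] * q) = Suc n"
    using assms by (subst degree_mult_eq) (auto simp: n_def)
  have "diff_op ([:- w, 1:] * q) u t =
      (\<Sum>i\<le>Suc n. (- w * coeff q i) * u i t) + (\<Sum>i\<le>Suc n. coeff (pCons 0 q) i * u i t)"
    unfolding diff_op_def deg sum.distrib[symmetric] by (intro sum.cong) (auto simp: algebra_simps)
  also have "(\<Sum>i\<le>Suc n. (- w * coeff q i) * u i t) = (\<Sum>i\<le>n. (- w * coeff q i) * u i t)"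
    by (simp add: n_def coeff_eq_0)
  also have "(\<Sum>i\<le>Suc n. coeff (pCons 0 q) i * u i t) = (\<Sum>i\<le>n. coeff q i * u (Suc i) t)"
    by (subst sum.atMost_Suc_shift) simp
  finally show ?thesis
    by (simp add: diff_op_def n_def sum.distrib[symmetric] algebra_simps)
qed

lemma exp_mult_has_vector_derivative:
  fixes w :: complex
  assumes "(g has_vector_derivative g') (at t within S)"
  shows "((\<lambda>t. exp (- w * of_real t) * g t) has_vector_derivative
           exp (- w * of_real t) * (g' - w * g t)) (at t within S)"
proof -
  have "((\<lambda>t. exp (- w * of_real t)) has_vector_derivative - w * exp (- w * of_real t)) (at t within S)"
    by (rule has_vector_derivative_real_field[where f = "\<lambda>z. exp (- w * z)"])
       (auto intro!: derivative_eq_intros)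
  from has_vector_derivative_mult[OF this assms] show ?thesis
    by (simp add: algebra_simps)
qed

text \<open>
  The \<open>+ 1\<close> in the exponent absorbs the powers of \<open>t\<close> that repeated integration would produce,
  so the bound reproduces itself.
\<close>

lemma first_order_bound:
  fixes g f :: "real \<Rightarrow> complex"
  assumes g': "\<And>t. t \<ge> 0 \<Longrightarrow> (g has_vector_derivative w * g t + f t) (at t within {0..})"
    and "g 0 = 0" and w: "Re w \<le> L" and K: "K \<ge> 0"
    and f: "\<And>t. t \<ge> 0 \<Longrightarrow> cmod (f t) \<le> K * exp ((L + 1) * t)"
    and t: "t \<ge> 0"
  shows "cmod (g t) \<le> K * exp ((L + 1) * t)"
proof (cases "t = 0")
  case True
  with K \<open>g 0 = 0\<close> show ?thesis by simp
next
  case False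
  with t have "t > 0" by simp
  \<comment> \<open>The growth rate that remains after the integrating factor
    \<open>exp (- w * of_real t)\<close>. Since \<open>c \<ge> 1\<close>, the derivative of
    \<open>K * exp (c * x)\<close> dominates the function itself, so this function can serve as
    majorant of \<open>h\<close>.\<close>
  define c where "c = L + 1 - Re w"
  have c: "c \<ge> 1" using w by (simp add: c_def)
  define h where "h = (\<lambda>t. exp (- w * of_real t) * g t)"
  have h': "(h has_vector_derivative exp (- w * of_real t) * f t) (at t within {0..})" if "t \<ge> 0" for t
    using exp_mult_has_vector_derivative[OF g'[OF that], of w] by (simp add: h_def)
  have "norm (h t - h 0) \<le> K * exp (c * t) - K * exp (c * 0)"
  proof (rule differentiable_bound_general[OF \<open>t > 0\<close>])
    have "continuous_on {0..} h"
      using h' by (auto simp: continuous_on_eq_continuous_within intro: has_vector_derivative_continuous)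
    then show "continuous_on {0..t} h" by (rule continuous_on_subset) auto
    show "continuous_on {0..t} (\<lambda>x. K * exp (c * x))" by (intro continuous_intros)
    fix x :: real assume x: "0 < x" "x < t"
    have "at x within {0..} = at x" using x by (intro at_within_interior) (simp add: interior_Ici[of "-1"])
    then show "(h has_vector_derivative exp (- w * of_real x) * f x) (at x)"
      using h'[of x] x by simp
    show "((\<lambda>x. K * exp (c * x)) has_vector_derivative K * (c * exp (c * x))) (at x)"
      by (auto intro!: derivative_eq_intros simp flip: has_real_derivative_iff_has_vector_derivative)
    have "cmod (exp (- w * of_real x) * f x) \<le> exp (- Re w * x) * (K * exp ((L + 1) * x))"
      using f[of x] x by (simp add: norm_mult)
    also have "\<dots> = 1 * (K * exp (c * x))"
      by (simp add: c_def algebra_simps exp_add[symmetric])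
    also have "\<dots> \<le> c * (K * exp (c * x))"
      using c K by (intro mult_right_mono) auto
    finally show "norm (exp (- w * of_real x) * f x) \<le> K * (c * exp (c * x))"
      by (simp add: mult_ac)
  qed
  then have "cmod (h t) \<le> K * exp (c * t)"
    using K \<open>g 0 = 0\<close> by (simp add: h_def)
  moreover have "cmod (h t) = exp (- Re w * t) * cmod (g t)"
    by (simp add: h_def norm_mult)
  ultimately have "exp (Re w * t) * (exp (- Re w * t) * cmod (g t)) \<le> exp (Re w * t) * (K * exp (c * t))"
    by (intro mult_left_mono) auto
  then show ?thesis
    by (simp add: c_def algebra_simps exp_add[symmetric] mult.assoc[symmetric])
qed

lemma degree_pos_factor:
  fixes p :: "complex poly"
  assumes "degree p = Suc n" "lead_coeff p = 1"
  obtains w q where "p = [:- w, 1:] * q" "degree q = n" "lead_coeff q = 1" "poly p w = 0"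
proof -
  have "\<not> constant (poly p)" using assms by (simp add: constant_degree)
  then obtain w where w: "poly p w = 0" using fundamental_theorem_of_algebra by blast
  then obtain q where q: "p = [:- w, 1:] * q" by (auto simp: poly_eq_0_iff_dvd)
  have "q \<noteq> 0" using q assms by auto
  then have "degree p = Suc (degree q)" unfolding q by (subst degree_mult_eq) auto
  moreover have "lead_coeff p = lead_coeff q" unfolding q by (subst lead_coeff_mult) auto
  ultimately show ?thesis using that[OF q] assms w by simp
qed

text \<open>Induction on the degree: after splitting off a root \<open>w\<close>, the sequence
  \<open>v\<close> for u' - w u solves the equation for \<open>q\<close> with the same right-hand
  side and zero data, so \<open>v 0\<close> obeys the bound. Then \<open>first_order_bound\<close>
  recovers \<open>u 0\<close> from \<open>v 0\<close>. Neither \<open>K\<close> nor \<open>L\<close>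
  changes on the way.\<close>

lemma diff_op_bound:
  assumes "degree p = n" "lead_coeff p = 1"
    and "\<And>w. poly p w = 0 \<Longrightarrow> Re w \<le> L"
    and "deriv_chain n u" "\<And>k. k < n \<Longrightarrow> u k 0 = 0"
    and K: "K \<ge> 0"
    and f: "\<And>t. t \<ge> 0 \<Longrightarrow> cmod (diff_op p u t) \<le> K * exp ((L + 1) * t)"
    and "t \<ge> 0"
  shows "cmod (u 0 t) \<le> K * exp ((L + 1) * t)"
  using assms
proof (induction n arbitrary: p u t)
  case 0
  then show ?case by (force simp: diff_op_def)
next
  case (Suc n)
  obtain w q where q: "p = [:- w, 1:] * q" "degree q = n" "lead_coeff q = 1" and w: "poly p w = 0"
    using degree_pos_factor Suc.prems(1,2) by metis
  define v where "v = (\<lambda>k t. u (Suc k) t - w * u k t)"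
  have "q \<noteq> 0" using q by auto
  have v: "cmod (v 0 t) \<le> K * exp ((L + 1) * t)" if "t \<ge> 0" for t
  proof (rule Suc.IH[OF q(2,3)])
    show "Re z \<le> L" if "poly q z = 0" for z
      using that Suc.prems(3)[of z] by (simp add: q)
    show "deriv_chain n v"
      using Suc.prems(4) unfolding deriv_chain_def v_def
      by (auto intro!: derivative_eq_intros)
    show "v k 0 = 0" if "k < n" for k
      using that Suc.prems(5) by (simp add: v_def)
    show "cmod (diff_op q v t) \<le> K * exp ((L + 1) * t)" if "t \<ge> 0" for t
      using Suc.prems(7)[OF that] diff_op_linear_factor[OF \<open>q \<noteq> 0\<close>, of w u t] by (simp add: q(1) v_def)
  qed (use K that in auto)
  show ?case
  proof (rule first_order_bound[OF _ _ _ K v])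
    show "(u 0 has_vector_derivative w * u 0 t + v 0 t) (at t within {0..})" if "t \<ge> 0" for t
      using Suc.prems(4) that by (auto simp: deriv_chain_def v_def)
    show "Re w \<le> L" using Suc.prems(3) w by blast
  qed (use Suc.prems in auto)
qed

text \<open>The last initial value is 1, so \<open>diff_op_bound\<close> cannot be used for
  \<open>p\<close> itself. With one root split off, \<open>f = diff_op q u\<close> satisfies f' = w
  f, and f(0) = 1 because \<open>q\<close> is monic of degree \<open>n\<close>; hence f(t) = exp(w
  t). The data of \<open>u\<close> below order \<open>n\<close> vanish, so
  \<open>diff_op_bound\<close> applies to \<open>q\<close> with \<open>K = 1\<close>.\<close>

lemma fundamental_solution_bound:
  assumes p: "degree p = Suc n" "lead_coeff p = 1"
    and L: "\<And>w. poly p w = 0 \<Longrightarrow> Re w \<le> L"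
    and u: "deriv_chain (Suc n) u" "\<And>k. k < n \<Longrightarrow> u k 0 = 0" "u n 0 = 1"
    and hom: "\<And>t. t \<ge> 0 \<Longrightarrow> diff_op p u t = 0"
    and "t \<ge> 0"
  shows "cmod (u 0 t) \<le> exp ((L + 1) * t)"
proof -
  obtain w q where q: "p = [:- w, 1:] * q" "degree q = n" "lead_coeff q = 1" and w: "poly p w = 0"
    using degree_pos_factor p by metis
  have "q \<noteq> 0" using q by auto
  define f where "f = diff_op q u"
  have f': "(f has_vector_derivative w * f t) (at t within {0..})" if "t \<ge> 0" for t
  proof -
    have "(f has_vector_derivative (\<Sum>i\<le>n. coeff q i * u (Suc i) t)) (at t within {0..})"
      unfolding f_def diff_op_def[abs_def] q(2)
      using u(1) that by (intro has_vector_derivative_sum) (auto intro!: derivative_eq_intros simp: deriv_chain_def)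
    moreover have "(\<Sum>i\<le>n. coeff q i * u (Suc i) t) - w * f t = diff_op p u t"
      unfolding q(1) diff_op_linear_factor[OF \<open>q \<noteq> 0\<close>]
      by (simp add: f_def diff_op_def q(2) algebra_simps sum_subtractf sum_distrib_left)
    ultimately show ?thesis using hom[OF that] by simp
  qed
  define h where "h = (\<lambda>t. exp (- w * of_real t) * f t)"
  have "(h has_vector_derivative 0) (at t within {0..})" if "t \<in> {0..}" for t
    using exp_mult_has_vector_derivative[OF f', of t w] that by (simp add: h_def)
  then obtain c where "\<And>t. t \<in> {0..} \<Longrightarrow> h t = c"
    using has_vector_derivative_zero_constant[of "{0..}" h] by auto
  then have h: "h t = h 0" if "t \<ge> 0" for t using that by force
  have "f 0 = 1"
  proof -
    have "f 0 = (\<Sum>i\<le>n. if i = n then 1 else 0)"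
      unfolding f_def diff_op_def q(2) using u(2,3) q(2,3) by (intro sum.cong) auto
    then show ?thesis by simp
  qed
  have f: "f t = exp (w * of_real t)" if "t \<ge> 0" for t
  proof -
    have "exp (w * of_real t) * h t = exp (w * of_real t)"
      using h[OF that] \<open>f 0 = 1\<close> by (simp add: h_def)
    then show ?thesis by (simp add: h_def mult.assoc[symmetric] exp_add[symmetric])
  qed
  have "cmod (u 0 t) \<le> 1 * exp ((L + 1) * t)"
  proof (rule diff_op_bound[OF q(2,3)])
    show "Re z \<le> L" if "poly q z = 0" for z
      using that L[of z] by (simp add: q)
    show "deriv_chain n u" using u(1) by (simp add: deriv_chain_def)
    show "cmod (diff_op q u t) \<le> 1 * exp ((L + 1) * t)" if "t \<ge> 0" for t
    proof -
      have "Re w * t \<le> (L + 1) * t" using L[OF w] that by (intro mult_right_mono) auto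
      then show ?thesis using f[OF that] by (simp add: f_def)
    qed
  qed (use u \<open>t \<ge> 0\<close> in auto)
  then show ?thesis by simp
qed

section \<open>Entire functions of several variables and Cauchy estimates\<close>

text \<open>Joint continuity plus holomorphy in each variable is Osgood's description of entire
  functions; it reduces everything to one complex variable.\<close>

definition sep_entire :: "(complex ^ 'n::finite \<Rightarrow> complex) \<Rightarrow> bool" where
  "sep_entire G \<longleftrightarrow>
     continuous_on UNIV G \<and> (\<forall>j z. (\<lambda>w. G (z + axis j w)) holomorphic_on UNIV)"

definition cpartial :: "'n::finite \<Rightarrow> (complex ^ 'n \<Rightarrow> complex) \<Rightarrow> complex ^ 'n \<Rightarrow> complex" where
  "cpartial j G z = deriv (\<lambda>w. G (z + axis j w)) 0"

lemma axis_add: "axis j (v + w) = axis j v + (axis j w :: 'a::monoid_add ^ 'n)"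
  by (simp add: vec_eq_iff axis_def)

lemma continuous_on_axis [continuous_intros]:
  fixes f :: "'a::topological_space \<Rightarrow> 'b::{real_normed_vector}"
  assumes "continuous_on S f"
  shows "continuous_on S (\<lambda>x. axis j (f x))"
  unfolding axis_def
proof (rule continuous_on_vec_lambda)
  show "continuous_on S (\<lambda>x. if i = j then f x else 0)" for i
    using assms by (cases "i = j") auto
qed

text \<open>\<open>cpartial\<close> differentiates at 0 only; translating the base point along the
  axis gives the derivative of a slice at every \<open>v\<close>.\<close>

lemma cpartial_has_field_derivative:
  assumes "sep_entire G"
  shows "((\<lambda>w. G (z + axis j w)) has_field_derivative cpartial j G (z + axis j v)) (at v)"
proof -
  have "(\<lambda>w. G ((z + axis j v) + axis j w)) holomorphic_on UNIV"
    using assms by (simp add: sep_entire_def)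
  then have "((\<lambda>w. G ((z + axis j v) + axis j w)) has_field_derivative cpartial j G (z + axis j v)) (at 0)"
    unfolding cpartial_def by (rule holomorphic_derivI) auto
  moreover have "(\<lambda>w. G ((z + axis j v) + axis j w)) = (\<lambda>w. G (z + axis j (w + v)))"
    by (simp add: axis_add algebra_simps)
  ultimately show ?thesis
    using DERIV_shift[of "\<lambda>w. G (z + axis j w)" "cpartial j G (z + axis j v)" 0 v] by simp
qed

text \<open>Cauchy's formula on the unit circle. The path does not depend on \<open>z\<close>, so
  regularity of the derivative in \<open>z\<close> follows from theorems on parameter
  integrals.\<close>

lemma cpartial_eq_integral:
  assumes "sep_entire G"
  shows "cpartial j G z = integral (cbox 0 (2 * pi)) (\<lambda>t. G (z + axis j (cis t)) * (cis (- t) / (2 * pi)))"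
proof -
  define g where "g = (\<lambda>w. G (z + axis j w))"
  have "g holomorphic_on UNIV" using assms by (simp add: g_def sep_entire_def)
  then have "(g has_field_derivative (1 / (2 * of_real pi * \<i>) *
      contour_integral (circlepath 0 1) (\<lambda>u. g u / (u - 0)^2))) (at 0)"
    by (intro Cauchy_derivative_integral_circlepath)
       (auto intro: holomorphic_on_subset holomorphic_on_imp_continuous_on)
  then have "cpartial j G z = 1 / (2 * of_real pi * \<i>) * contour_integral (circlepath 0 1) (\<lambda>u. g u / u^2)"
    by (simp add: cpartial_def g_def DERIV_imp_deriv)
  also have "contour_integral (circlepath 0 1) (\<lambda>u. g u / u^2) =
      integral {0..2 * pi} (\<lambda>t. g (cis t) / (cis t)^2 * \<i> * cis t)"
    unfolding circlepath_def by (subst contour_integral_part_circlepath_eq) auto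
  also have "1 / (2 * of_real pi * \<i>) * \<dots> =
      integral {0..2 * pi} (\<lambda>t. 1 / (2 * of_real pi * \<i>) * (g (cis t) / (cis t)^2 * \<i> * cis t))"
    by (rule integral_mult_right[symmetric])
  also have "(\<lambda>t. 1 / (2 * of_real pi * \<i>) * (g (cis t) / (cis t)^2 * \<i> * cis t)) =
      (\<lambda>t. g (cis t) * (cis (- t) / (2 * pi)))"
  proof
    fix t
    have "cis (- t) = 1 / cis t" by (simp add: divide_inverse)
    then show "1 / (2 * of_real pi * \<i>) * (g (cis t) / (cis t)^2 * \<i> * cis t) =
        g (cis t) * (cis (- t) / (2 * pi))"
      by (simp only:) (simp add: power2_eq_square)
  qed
  finally show ?thesis by (simp add: g_def)
qed

lemma continuous_on_cis_shift:
  assumes "continuous_on UNIV G"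
  shows "continuous_on S (\<lambda>(z, t). G (z + axis j (cis t)) * (cis (- t) / (2 * pi)))"
  unfolding case_prod_unfold
  by (intro continuous_intros continuous_on_compose2[OF assms]) (auto intro!: continuous_intros)

lemma sep_entire_cpartial:
  assumes G: "sep_entire G"
  shows "sep_entire (cpartial j G)"
proof -
  have cont: "continuous_on UNIV (cpartial j G)" for j
  proof -
    have "continuous_on UNIV G" using G by (simp add: sep_entire_def)
    then show ?thesis
      unfolding cpartial_eq_integral[OF G, abs_def]
      by (intro integral_continuous_on_param continuous_on_cis_shift)
  qed
  \<comment> \<open>Differentiation under the integral sign. The required continuity of the
    integrand's derivative in \<open>(v, t)\<close> comes from \<open>cont\<close>, taken for the
    direction \<open>k\<close>.\<close>
  have "(\<lambda>v. cpartial j G (z + axis k v)) holomorphic_on UNIV" for k z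
    unfolding cpartial_eq_integral[OF G, of j]
  proof (rule leibniz_rule_holomorphic)
    fix v :: complex and t :: real
    have "((\<lambda>v. G (z + axis j (cis t) + axis k v)) has_field_derivative
        cpartial k G (z + axis j (cis t) + axis k v)) (at v)"
      by (rule cpartial_has_field_derivative[OF G])
    then show "((\<lambda>v. G (z + axis k v + axis j (cis t)) * (cis (- t) / (2 * pi))) has_field_derivative
        cpartial k G (z + axis k v + axis j (cis t)) * (cis (- t) / (2 * pi))) (at v within UNIV)"
      by (intro DERIV_cmult_right) (simp add: ac_simps)
  next
    fix v :: complex
    have contG: "continuous_on UNIV G" using G by (simp add: sep_entire_def)
    show "(\<lambda>t. G (z + axis k v + axis j (cis t)) * (cis (- t) / (2 * pi))) integrable_on cbox 0 (2 * pi)"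
      by (intro integrable_continuous continuous_intros continuous_on_compose2[OF contG])
         (auto intro!: continuous_intros)
  next
    show "continuous_on (UNIV \<times> cbox 0 (2 * pi))
        (\<lambda>(v, t). cpartial k G (z + axis k v + axis j (cis t)) * (cis (- t) / (2 * pi)))"
      unfolding case_prod_unfold
      by (intro continuous_intros continuous_on_compose2[OF cont]) (auto intro!: continuous_intros)
  qed auto
  with cont show ?thesis by (simp add: sep_entire_def)
qed

lemma sep_entire_foldr_cpartial: "sep_entire G \<Longrightarrow> sep_entire (foldr cpartial js G)"
  by (induction js) (auto intro: sep_entire_cpartial)

lemma Im_vec_add_axis: "Im_vec (z + axis j w) = Im_vec z + Im w *\<^sub>R axis j 1"
  by (simp add: vec_eq_iff Im_vec_def axis_def)

text \<open>Each derivative costs a factor \<open>1 / r\<close> and a disc of radius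
  \<open>r\<close>, which moves the imaginary part by at most \<open>r\<close>. The induction
  therefore widens the strip for the inner function to \<open>\<rho> + r\<close>.\<close>

lemma cmod_foldr_cpartial_le:
  assumes "sep_entire G" "r > 0"
    and "\<And>z. norm (Im_vec z) \<le> \<rho> + real (length js) * r \<Longrightarrow> cmod (G z) \<le> B"
    and "norm (Im_vec z) \<le> \<rho>"
  shows "cmod (foldr cpartial js G z) \<le> B / r ^ length js"
  using assms(3,4)
proof (induction js arbitrary: \<rho> z)
  case Nil
  then show ?case by simp
next
  case (Cons j js)
  let ?H = "foldr cpartial js G"
  have IH: "cmod (?H z) \<le> B / r ^ length js" if "norm (Im_vec z) \<le> \<rho> + r" for z
    using that by (intro Cons.IH[of "\<rho> + r"] Cons.prems(1)) (auto simp: algebra_simps)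
  have hol: "(\<lambda>w. ?H (z + axis j w)) holomorphic_on UNIV"
    using sep_entire_foldr_cpartial[OF assms(1)] by (simp add: sep_entire_def)
  have "cmod ((deriv ^^ 1) (\<lambda>w. ?H (z + axis j w)) 0) \<le> fact 1 * (B / r ^ length js) / r ^ 1"
  proof (rule Cauchy_inequality)
    fix w :: complex assume "cmod (0 - w) = r"
    then have "\<bar>Im w\<bar> \<le> r" using abs_Im_le_cmod[of w] by simp
    then have "norm (Im_vec (z + axis j w)) \<le> \<rho> + r"
      using Cons.prems(2) norm_triangle_ineq[of "Im_vec z" "Im w *\<^sub>R axis j 1"]
      by (simp add: Im_vec_add_axis)
    then show "cmod (?H (z + axis j w)) \<le> B / r ^ length js" by (rule IH)
  qed (use hol \<open>r > 0\<close> in \<open>auto intro: holomorphic_on_subset holomorphic_on_imp_continuous_on\<close>)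
  then show ?case by (simp add: cpartial_def[of j ?H z] mult.commute[of r])
qed

section \<open>Restriction to the real space\<close>

lemma cvec_add_axis: "cvec (x + h *\<^sub>R axis j 1) = cvec x + axis j (of_real h)"
  by (simp add: vec_eq_iff cvec_def axis_def)

lemma Im_vec_cvec [simp]: "Im_vec (cvec x) = 0"
  by (simp add: vec_eq_iff cvec_def Im_vec_def)

lemma continuous_on_cvec: "continuous_on S cvec"
  unfolding cvec_def by (intro continuous_intros)

text \<open>A real partial derivative is the complex one taken along the real line of the
  slice.\<close>

lemma cvec_restriction_has_vector_derivative:
  assumes "sep_entire G"
  shows "((\<lambda>h. G (cvec (x + h *\<^sub>R axis j 1))) has_vector_derivative cpartial j G (cvec x)) (at 0)"
  unfolding cvec_add_axis
  using has_vector_derivative_real_field[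
      OF cpartial_has_field_derivative[OF assms, of "cvec x" j "of_real 0"]]
  by (simp add: axis_def vec_eq_iff zero_vec_def[symmetric])

lemma iter_partial_cvec:
  assumes "sep_entire G"
  shows "iter_partial js (\<lambda>x. G (cvec x)) = (\<lambda>x. foldr cpartial js G (cvec x))"
proof (induction js)
  case (Cons j js)
  show ?case
    using cvec_restriction_has_vector_derivative[OF sep_entire_foldr_cpartial[OF assms]]
    by (simp add: Cons.IH partial_deriv_def fun_eq_iff vector_derivative_at)
qed simp

lemma smooth_fun_cvec:
  assumes "sep_entire G"
  shows "smooth_fun (\<lambda>x. G (cvec x))"
  unfolding smooth_fun_def iter_partial_cvec[OF assms]
proof (intro allI conjI)
  fix js
  have H: "sep_entire (foldr cpartial js G)" by (rule sep_entire_foldr_cpartial[OF assms])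
  then show "continuous_on UNIV (\<lambda>x. foldr cpartial js G (cvec x))"
    by (intro continuous_on_compose2[OF _ continuous_on_cvec]) (auto simp: sep_entire_def)
  show "(\<lambda>h. foldr cpartial js G (cvec (x + h *\<^sub>R axis j 1))) differentiable at 0" for j x
    using cvec_restriction_has_vector_derivative[OF H] differentiableI_vector by blast
qed

section \<open>Polynomials and locally uniform series\<close>

lemma sep_entire_peval: "sep_entire (peval p)"
proof -
  have coord: "(\<lambda>w. (z + axis j w) $ i) holomorphic_on UNIV" for z :: "complex ^ 'n" and i j
    by (cases "i = j") (auto simp: axis_def intro!: holomorphic_intros)
  then show ?thesis
    unfolding sep_entire_def peval_def[abs_def]
    by (auto intro!: continuous_intros holomorphic_intros simp del: vector_add_component)
qed

lemma sep_entire_suminf: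
  assumes f: "\<And>n. sep_entire (f n)"
    and bound: "\<And>R. \<exists>M. summable M \<and> (\<forall>n. \<forall>z\<in>cball 0 R. cmod (f n z) \<le> M n)"
  shows "sep_entire (\<lambda>z. suminf (\<lambda>n. f n z))"
  unfolding sep_entire_def
proof (intro conjI allI)
  have "continuous_on (ball 0 R) (\<lambda>z. suminf (\<lambda>n. f n z))" for R
  proof -
    obtain M where M: "summable M" "\<And>n z. z \<in> cball 0 R \<Longrightarrow> cmod (f n z) \<le> M n"
      using bound[of R] by blast
    have lim: "uniform_limit (ball 0 R) (\<lambda>n z. \<Sum>i<n. f i z) (\<lambda>z. suminf (\<lambda>n. f n z)) sequentially"
      using M by (intro Weierstrass_m_test) auto
    have cont: "continuous_on UNIV (f i)" for i
      using f by (simp add: sep_entire_def)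
    have "continuous_on (ball 0 R) (\<lambda>z. \<Sum>i<n. f i z)" for n
      by (intro continuous_on_sum continuous_on_subset[OF cont] subset_UNIV)
    then show ?thesis
      by (intro uniform_limit_theorem[OF _ lim] always_eventually) auto
  qed
  then have "isCont (\<lambda>z. suminf (\<lambda>n. f n z)) z" for z
    by (rule continuous_on_interior[where S = "ball 0 (norm z + 1)"]) auto
  then show "continuous_on UNIV (\<lambda>z. suminf (\<lambda>n. f n z))"
    by (simp add: continuous_on_eq_continuous_at)
next
  fix j z
  show "(\<lambda>w. suminf (\<lambda>n. f n (z + axis j w))) holomorphic_on UNIV"
  proof (rule holomorphic_uniform_sequence[where f = "\<lambda>n w. \<Sum>i<n. f i (z + axis j w)"])
    show "(\<lambda>w. \<Sum>i<n. f i (z + axis j w)) holomorphic_on UNIV" for n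
      using f by (intro holomorphic_on_sum) (auto simp: sep_entire_def)
    fix x
    \<comment> \<open>A disc in the slice lies in some ball about 0, so the majorant for that ball
      gives uniform convergence on the disc.\<close>
    have "compact ((\<lambda>w. z + axis j w) ` cball x 1)"
      by (intro compact_continuous_image continuous_intros compact_cball)
    then have "bounded ((\<lambda>w. z + axis j w) ` cball x 1)" by (rule compact_imp_bounded)
    then obtain R where R: "(\<lambda>w. z + axis j w) ` cball x 1 \<subseteq> cball 0 R"
      using bounded_subset_ballD[of _ 0] ball_subset_cball by (metis order_trans)
    obtain M where M: "summable M" "\<And>n z. z \<in> cball 0 R \<Longrightarrow> cmod (f n z) \<le> M n"
      using bound[of R] by blast
    have "uniform_limit (cball x 1) (\<lambda>n w. \<Sum>i<n. f i (z + axis j w))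
        (\<lambda>w. suminf (\<lambda>n. f n (z + axis j w))) sequentially"
    proof (rule Weierstrass_m_test[OF _ M(1)])
      show "cmod (f n (z + axis j w)) \<le> M n" if "w \<in> cball x 1" for n w
        using that R by (intro M(2)) blast
    qed
    then show "\<exists>d>0. cball x d \<subseteq> UNIV \<and> uniform_limit (cball x d) (\<lambda>n w. \<Sum>i<n. f i (z + axis j w))
        (\<lambda>w. suminf (\<lambda>n. f n (z + axis j w))) sequentially"
      by (intro exI[of _ 1]) auto
  qed auto
qed

section \<open>The power series solution in time\<close>

text \<open>The n-th time derivative of the solution at 0: the first \<open>m\<close> values are the
  data 0, ..., 0, 1, and the later ones come from differentiating the equation \<open>n - m\<close>
  times.\<close>

fun rec_seq :: "nat \<Rightarrow> (nat \<Rightarrow> complex) \<Rightarrow> nat \<Rightarrow> complex" where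
  "rec_seq m b n = (if n < m then of_bool (Suc n = m) else - (\<Sum>k=1..m. b k * rec_seq m b (n - k)))"

text \<open>As a rewrite rule the unconditional recursion could unfold forever.\<close>

declare rec_seq.simps [simp del]

text \<open>Geometric growth, so that division by n! makes the series in \<open>t\<close> converge
  everywhere.\<close>

lemma cmod_rec_seq_le: "cmod (rec_seq m b n) \<le> (1 + (\<Sum>k=1..m. cmod (b k))) ^ n"
proof (induction n rule: less_induct)
  case (less n)
  let ?B = "\<Sum>k=1..m. cmod (b k)"
  have B: "?B \<ge> 0" by (intro sum_nonneg) auto
  show ?case
  proof (cases "n < m")
    case True
    have "cmod (rec_seq m b n) \<le> 1" using True by (subst rec_seq.simps) auto
    also have "1 \<le> (1 + ?B) ^ n" using B by (intro one_le_power) auto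
    finally show ?thesis .
  next
    case False
    show ?thesis
    proof (cases "m = 0")
      case True
      then show ?thesis by (subst rec_seq.simps) auto
    next
      case m: False
      with False have n: "n = Suc (n - 1)" by simp
      have "cmod (rec_seq m b n) \<le> (\<Sum>k=1..m. cmod (b k * rec_seq m b (n - k)))"
        using False by (subst rec_seq.simps) (auto intro: norm_sum)
      also have "\<dots> \<le> (\<Sum>k=1..m. cmod (b k) * (1 + ?B) ^ (n - 1))"
      proof (rule sum_mono)
        fix k assume k: "k \<in> {1..m}"
        have "cmod (rec_seq m b (n - k)) \<le> (1 + ?B) ^ (n - k)"
          using k False by (intro less.IH) auto
        also have "\<dots> \<le> (1 + ?B) ^ (n - 1)"
          using k B by (intro power_increasing) auto
        finally show "cmod (b k * rec_seq m b (n - k)) \<le> cmod (b k) * (1 + ?B) ^ (n - 1)"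
          by (simp add: norm_mult mult_left_mono)
      qed
      also have "\<dots> = ?B * (1 + ?B) ^ (n - 1)" by (simp add: sum_distrib_right)
      also have "\<dots> \<le> (1 + ?B) * (1 + ?B) ^ (n - 1)"
        using B by (intro mult_right_mono) auto
      also have "\<dots> = (1 + ?B) ^ n" by (subst (2) n) simp
      finally show ?thesis .
    qed
  qed
qed

lemma rec_seq_add: "rec_seq m b (n + m) + (\<Sum>k=1..m. b k * rec_seq m b (n + (m - k))) = 0"
proof -
  have "(\<Sum>k=1..m. b k * rec_seq m b (n + (m - k))) = (\<Sum>k=1..m. b k * rec_seq m b (n + m - k))"
    by (intro sum.cong) auto
  then show ?thesis by (subst rec_seq.simps) simp
qed

lemma sep_entire_rec_seq:
  assumes "\<And>k. sep_entire (b k)"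
  shows "sep_entire (\<lambda>z. rec_seq m (\<lambda>k. b k z) n)"
proof (induction n rule: less_induct)
  case (less n)
  show ?case
  proof (cases "n < m")
    case True
    then show ?thesis by (subst rec_seq.simps) (auto simp: sep_entire_def)
  next
    case False
    have "sep_entire (\<lambda>z. rec_seq m (\<lambda>k. b k z) (n - k))" if "k \<in> {1..m}" for k
      using that False by (intro less.IH) auto
    with False assms show ?thesis
      by (subst rec_seq.simps)
         (auto simp: sep_entire_def simp del: atLeastAtMost_iff intro!: continuous_intros holomorphic_intros)
  qed
qed

text \<open>Shifting the coefficients by \<open>k\<close> gives the k-th derivative of the series,
  so \<open>rec_sol m b\<close> is already a sequence fit for \<open>deriv_chain\<close>.\<close>

definition rec_sol :: "nat \<Rightarrow> (nat \<Rightarrow> complex) \<Rightarrow> nat \<Rightarrow> real \<Rightarrow> complex" where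
  "rec_sol m b k t = suminf (\<lambda>n. rec_seq m b (n + k) / fact n * of_real t ^ n)"

text \<open>The majorant depends on \<open>b\<close> only through \<open>A\<close>, so it gives both
  summability for fixed \<open>b\<close> and uniform convergence when \<open>b\<close> varies with a
  bounded sum.\<close>

lemma cmod_rec_sol_term_le:
  assumes "1 + (\<Sum>k=1..m. cmod (b k)) \<le> A"
  shows "cmod (rec_seq m b (n + k) / fact n * x ^ n) \<le> A ^ k * (inverse (fact n) * (A * cmod x) ^ n)"
proof -
  have "cmod (rec_seq m b (n + k)) \<le> (1 + (\<Sum>k=1..m. cmod (b k))) ^ (n + k)"
    by (rule cmod_rec_seq_le)
  also have "\<dots> \<le> A ^ (n + k)"
    using assms by (intro power_mono add_nonneg_nonneg sum_nonneg) auto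
  finally have "cmod (rec_seq m b (n + k)) * (cmod x ^ n / fact n) \<le> A ^ (n + k) * (cmod x ^ n / fact n)"
    by (intro mult_right_mono) auto
  then show ?thesis
    by (simp add: norm_mult norm_divide norm_power power_add power_mult_distrib field_simps)
qed

lemma summable_rec_sol: "summable (\<lambda>n. rec_seq m b (n + k) / fact n * x ^ n)"
  by (rule summable_comparison_test'[OF summable_mult[OF summable_exp]])
     (rule cmod_rec_sol_term_le[OF order.refl])

lemma rec_sol_has_vector_derivative:
  "(rec_sol m b k has_vector_derivative rec_sol m b (Suc k) t) (at t within S)"
proof -
  have "diffs (\<lambda>n. rec_seq m b (n + k) / fact n) = (\<lambda>n. rec_seq m b (n + Suc k) / fact n)"
    by (rule ext) (simp add: diffs_def field_simps del: of_nat_Suc)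
  with termdiffs_strong_converges_everywhere[OF summable_rec_sol, of m b k "of_real t"]
  show ?thesis
    unfolding rec_sol_def[abs_def] by (intro has_vector_derivative_real_field) (simp only:)
qed

lemma rec_sol_0: "rec_sol m b k 0 = rec_seq m b k"
  using powser_zero[of "\<lambda>n. rec_seq m b (n + k) / fact n"] by (simp add: rec_sol_def)

lemma rec_sol_ode: "rec_sol m b m t + (\<Sum>k=1..m. b k * rec_sol m b (m - k) t) = 0"
proof -
  have sum_eq: "(\<Sum>k=1..m. b k * rec_sol m b (m - k) t) =
      suminf (\<lambda>n. \<Sum>k=1..m. b k * (rec_seq m b (n + (m - k)) / fact n * of_real t ^ n))"
    unfolding rec_sol_def suminf_mult[OF summable_rec_sol, symmetric]
    by (rule suminf_sum[symmetric]) (intro summable_mult summable_rec_sol)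
  have "rec_sol m b m t + (\<Sum>k=1..m. b k * rec_sol m b (m - k) t) =
      suminf (\<lambda>n. rec_seq m b (n + m) / fact n * of_real t ^ n +
        (\<Sum>k=1..m. b k * (rec_seq m b (n + (m - k)) / fact n * of_real t ^ n)))"
    unfolding sum_eq unfolding rec_sol_def
    by (rule suminf_add) (intro summable_sum summable_mult summable_rec_sol)+
  also have "\<dots> = suminf (\<lambda>n. (rec_seq m b (n + m) + (\<Sum>k=1..m. b k * rec_seq m b (n + (m - k)))) / fact n * of_real t ^ n)"
    by (simp add: algebra_simps add_divide_distrib sum_distrib_left sum_divide_distrib)
  finally show ?thesis by (simp only: rec_seq_add) simp
qed

section \<open>Characteristic polynomial, growth and uniqueness\<close>

definition char_poly :: "nat \<Rightarrow> (nat \<Rightarrow> complex) \<Rightarrow> complex poly" where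
  "char_poly m b = monom 1 m + (\<Sum>k=1..m. monom (b k) (m - k))"

lemma coeff_char_poly: "coeff (char_poly m b) i = (if i = m then 1 else if i < m then b (m - i) else 0)"
proof -
  have "coeff (char_poly m b) i = of_bool (i = m) + (\<Sum>k=1..m. if m - k = i then b k else 0)"
    by (simp add: char_poly_def coeff_sum eq_commute[of m i])
  \<comment> \<open>For \<open>k\<close> in \<open>{1..m}\<close> the truncated difference
    \<open>m - k\<close> equals \<open>i\<close> exactly if \<open>k = m - i\<close> and
    \<open>i < m\<close>, which leaves a single term.\<close>
  also have "(\<Sum>k=1..m. if m - k = i then b k else 0) = (\<Sum>k=1..m. if k = m - i \<and> i < m then b k else 0)"
    by (intro sum.cong) auto
  also have "\<dots> = (if i < m then b (m - i) else 0)" by (auto simp: sum.delta)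
  finally show ?thesis by auto
qed

lemma degree_char_poly [simp]: "degree (char_poly m b) = m"
  by (rule antisym) (auto intro!: degree_le le_degree simp: coeff_char_poly)

lemma poly_char_poly: "poly (char_poly m b) w = w ^ m + (\<Sum>k=1..m. b k * w ^ (m - k))"
  by (simp add: char_poly_def poly_sum poly_monom)

lemma diff_op_char_poly: "diff_op (char_poly m b) u t = u m t + (\<Sum>k=1..m. b k * u (m - k) t)"
proof -
  have "diff_op (char_poly m b) u t = (\<Sum>i<m. b (m - i) * u i t) + u m t"
    unfolding diff_op_def degree_char_poly lessThan_Suc_atMost[symmetric]
    by (simp add: coeff_char_poly)
  also have "(\<Sum>i<m. b (m - i) * u i t) = (\<Sum>k=1..m. b k * u (m - k) t)"
    by (rule sum.reindex_bij_witness[of _ "\<lambda>k. m - k" "\<lambda>i. m - i"]) auto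
  finally show ?thesis by simp
qed

lemma rec_sol_bound:
  assumes "m \<ge> 1" "t \<ge> 0"
    and "\<And>w. w ^ m + (\<Sum>k=1..m. b k * w ^ (m - k)) = 0 \<Longrightarrow> Re w \<le> L"
  shows "cmod (rec_sol m b 0 t) \<le> exp ((L + 1) * t)"
proof -
  obtain n where m: "m = Suc n" using assms(1) by (cases m) auto
  show ?thesis
  proof (rule fundamental_solution_bound[of "char_poly m b" n])
    show "deriv_chain (Suc n) (rec_sol m b)"
      by (simp add: deriv_chain_def rec_sol_has_vector_derivative)
    show "rec_sol m b k 0 = 0" if "k < n" for k
      using that by (simp add: rec_sol_0 rec_seq.simps m)
    show "rec_sol m b n 0 = 1" by (simp add: rec_sol_0 rec_seq.simps m)
    show "diff_op (char_poly m b) (rec_sol m b) t = 0" for t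
      by (simp only: diff_op_char_poly rec_sol_ode)
  qed (use assms in \<open>auto simp: m coeff_char_poly poly_char_poly\<close>)
qed

text \<open>The difference of two solutions has zero data and zero right-hand side, so the growth
  bound with \<open>K = 0\<close> makes it vanish.\<close>

lemma ode_unique:
  assumes "deriv_chain m u" "deriv_chain m v" "\<And>k. k < m \<Longrightarrow> u k 0 = v k 0"
    and "\<And>t. t \<ge> 0 \<Longrightarrow> u m t + (\<Sum>k=1..m. b k * u (m - k) t) = 0"
    and "\<And>t. t \<ge> 0 \<Longrightarrow> v m t + (\<Sum>k=1..m. b k * v (m - k) t) = 0"
    and "t \<ge> 0"
  shows "u 0 t = v 0 t"
proof -
  \<comment> \<open>Any common upper bound for the real parts of the roots will do; this finite sum
    is one.\<close>
  define L where "L = (\<Sum>w | poly (char_poly m b) w = 0. \<bar>Re w\<bar>)"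
  have "char_poly m b \<noteq> 0"
    using coeff_char_poly[of m b m] by auto
  then have fin: "finite {w. poly (char_poly m b) w = 0}" by (rule poly_roots_finite)
  have "cmod ((\<lambda>k t. u k t - v k t) 0 t) \<le> 0 * exp ((L + 1) * t)"
  proof (rule diff_op_bound[of "char_poly m b" m])
    show "Re w \<le> L" if "poly (char_poly m b) w = 0" for w
    proof -
      have "\<bar>Re w\<bar> \<le> L" unfolding L_def using that fin by (intro member_le_sum) auto
      then show ?thesis by simp
    qed
    show "deriv_chain m (\<lambda>k t. u k t - v k t)"
      using assms(1,2) by (auto simp: deriv_chain_def intro!: derivative_eq_intros)
    show "cmod (diff_op (char_poly m b) (\<lambda>k t. u k t - v k t) t) \<le> 0 * exp ((L + 1) * t)" if "t \<ge> 0" for t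
    proof -
      have "diff_op (char_poly m b) (\<lambda>k t. u k t - v k t) t =
          (u m t + (\<Sum>k=1..m. b k * u (m - k) t)) - (v m t + (\<Sum>k=1..m. b k * v (m - k) t))"
        by (simp add: diff_op_char_poly algebra_simps sum_subtractf)
      then show ?thesis by (simp only: assms(4,5)[OF that]) simp
    qed
  qed (use assms in \<open>auto simp: coeff_char_poly\<close>)
  then show ?thesis by simp
qed

section \<open>The entire extension of the symbol\<close>

lemma sep_entire_rec_sol:
  assumes "\<And>k. sep_entire (b k)"
  shows "sep_entire (\<lambda>z. rec_sol m (\<lambda>k. b k z) 0 t)"
  unfolding rec_sol_def
proof (rule sep_entire_suminf)
  show "sep_entire (\<lambda>z. rec_seq m (\<lambda>k. b k z) (n + 0) / fact n * of_real t ^ n)" for n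
    using sep_entire_rec_seq[of b m n] assms
    by (auto simp: sep_entire_def intro!: continuous_intros holomorphic_intros)
  fix R :: real
  have "continuous_on UNIV (\<lambda>z. 1 + (\<Sum>k=1..m. cmod (b k z)))"
    using assms by (auto intro!: continuous_intros simp: sep_entire_def)
  then have "continuous_on (cball 0 R) (\<lambda>z. 1 + (\<Sum>k=1..m. cmod (b k z)))"
    by (rule continuous_on_subset) auto
  then have "bounded ((\<lambda>z. 1 + (\<Sum>k=1..m. cmod (b k z))) ` cball 0 R)"
    by (intro compact_imp_bounded compact_continuous_image) auto
  \<comment> \<open>\<open>A\<close> bounds the base of the geometric growth on the whole ball,
    which makes the majorant uniform in \<open>z\<close>.\<close>
  then obtain A where A: "\<And>z. z \<in> cball 0 R \<Longrightarrow> \<bar>1 + (\<Sum>k=1..m. cmod (b k z))\<bar> \<le> A"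
    unfolding bounded_iff by fastforce
  show "\<exists>M. summable M \<and> (\<forall>n. \<forall>z\<in>cball 0 R.
      cmod (rec_seq m (\<lambda>k. b k z) (n + 0) / fact n * of_real t ^ n) \<le> M n)"
  proof (intro exI conjI allI ballI)
    show "summable (\<lambda>n. A ^ 0 * (inverse (fact n) * (A * cmod (of_real t)) ^ n))"
      by (intro summable_mult summable_exp)
    show "cmod (rec_seq m (\<lambda>k. b k z) (n + 0) / fact n * of_real t ^ n)
        \<le> A ^ 0 * (inverse (fact n) * (A * cmod (of_real t)) ^ n)" if "z \<in> cball 0 R" for n z
      using A[OF that] by (intro cmod_rec_sol_term_le) auto
  qed
qed

lemma propagator_symbol_eq:
  assumes "propagator_symbol m a \<sigma>" "m \<ge> 1" "t \<ge> 0"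
  shows "\<sigma> t \<xi> = rec_sol m (\<lambda>k. peval (a k) (cvec \<xi>)) 0 t"
proof -
  define b where "b = (\<lambda>k. peval (a k) (cvec \<xi>))"
  have "\<exists>u. (\<forall>t\<ge>0. u 0 t = \<sigma> t \<xi>) \<and> deriv_chain m u \<and>
      (\<forall>t\<ge>0. u m t + (\<Sum>k=1..m. b k * u (m - k) t) = 0) \<and>
      (\<forall>k<m - 1. u k 0 = 0) \<and> u (m - 1) 0 = 1"
    using assms(1) by (simp add: propagator_symbol_def deriv_chain_def b_def)
  then obtain u where u: "\<And>t. t \<ge> 0 \<Longrightarrow> u 0 t = \<sigma> t \<xi>" "deriv_chain m u"
      "\<And>t. t \<ge> 0 \<Longrightarrow> u m t + (\<Sum>k=1..m. b k * u (m - k) t) = 0"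
      "\<And>k. k < m - 1 \<Longrightarrow> u k 0 = 0" "u (m - 1) 0 = 1"
    by auto
  have "u 0 t = rec_sol m b 0 t"
  proof (rule ode_unique[OF u(2) _ _ u(3) _ assms(3)])
    show "deriv_chain m (rec_sol m b)"
      by (simp add: deriv_chain_def rec_sol_has_vector_derivative)
    show "u k 0 = rec_sol m b k 0" if "k < m" for k
    proof (cases "k = m - 1")
      case True
      with that u(5) show ?thesis by (simp add: rec_sol_0 rec_seq.simps)
    next
      case False
      with that u(4)[of k] show ?thesis by (simp add: rec_sol_0 rec_seq.simps)
    qed
  qed (auto simp only: rec_sol_ode)
  with u(1)[OF assms(3)] show ?thesis by (simp add: b_def)
qed

section \<open>Multi-indices\<close>

text \<open>Guarantees that the \<open>SOME\<close> in \<open>multi_deriv\<close> picks a genuine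
  list: over a finite index type every \<open>\<alpha>\<close> has finite support and so counts a
  multiset.\<close>

lemma ex_count_list_eq: "\<exists>js. \<forall>j. count_list js j = (\<alpha> :: 'n::finite \<Rightarrow> nat) j"
proof -
  obtain js where "mset js = Abs_multiset \<alpha>" using ex_mset by blast
  then have "count_list js j = \<alpha> j" for j
    by (metis Abs_multiset_inverse count_mset finite mem_Collect_eq)
  then show ?thesis by blast
qed

lemma multi_abs_power_le:
  fixes \<alpha> :: "'n::finite \<Rightarrow> nat"
  shows "real (multi_abs \<alpha>) ^ multi_abs \<alpha> \<le>
    exp (real CARD('n) * real (multi_abs \<alpha>)) * multi_fact \<alpha>"
  \<comment> \<open>Multiply \<open>N\<^sup>k / k! \<le> e\<^sup>N\<close> over \<open>k = \<alpha>\<^sub>j\<close>.\<close>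
proof -
  define N where "N = real (multi_abs \<alpha>)"
  have "N \<ge> 0" by (simp add: N_def)
  have term_le: "N ^ k / fact k \<le> exp N" for k :: nat
  proof -
    have "(\<Sum>n\<in>{k}. inverse (fact n) * N ^ n) \<le> suminf (\<lambda>n. inverse (fact n) * N ^ n)"
      using \<open>N \<ge> 0\<close> by (intro sum_le_suminf summable_exp) auto
    also have "\<dots> = exp N" by (simp add: exp_def)
    finally have "(\<Sum>n\<in>{k}. inverse (fact n) * N ^ n) \<le> exp N" .
    then show ?thesis by (simp add: field_simps)
  qed
  have "N ^ multi_abs \<alpha> / multi_fact \<alpha> = (\<Prod>j\<in>UNIV. N ^ \<alpha> j / fact (\<alpha> j))"
    by (simp add: multi_abs_def multi_fact_def power_sum prod_dividef)
  also have "\<dots> \<le> (\<Prod>j\<in>(UNIV :: 'n set). exp N)"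
    using term_le \<open>N \<ge> 0\<close> by (intro prod_mono) auto
  also have "\<dots> = exp (real CARD('n) * N)" by (simp add: exp_of_nat_mult)
  finally have "N ^ multi_abs \<alpha> / multi_fact \<alpha> \<le> exp (real CARD('n) * N)" .
  moreover have "multi_fact \<alpha> > 0" by (simp add: multi_fact_def prod_pos)
  ultimately show ?thesis by (simp add: N_def field_simps)
qed

section \<open>Choice of the Cauchy radius and collection of constants\<close>

theorem theorem5p2:
  fixes m :: nat
    and a :: "nat \<Rightarrow> 'n::finite cpoly"
    and \<sigma> :: "real \<Rightarrow> real ^ 'n \<Rightarrow> complex"
    and C0 \<nu> s :: real
  assumes "m \<ge> 1"
    and "C0 > 0" and "\<nu> \<ge> 1"
    and "\<And>(\<tau>::complex) (\<zeta>::complex ^ 'n).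
           char_symbol m a (\<i> * \<tau>) \<zeta> = 0 \<Longrightarrow>
           Im \<tau> \<ge> - C0 * (1 + norm (Im_vec \<zeta>)) powr \<nu>"
    and "propagator_symbol m a \<sigma>"
    and "s = 1 - 1 / \<nu>"
  shows "(\<forall>t\<ge>0. smooth_fun (\<sigma> t)) \<and>
         (\<exists>C>0. \<forall>\<xi> t \<alpha>. t \<ge> 0 \<longrightarrow>
            cmod (multi_deriv \<alpha> (\<sigma> t) \<xi>)
              \<le> C powr ((t + 1) * real (multi_abs \<alpha>) + t) * multi_fact \<alpha> powr s)"
proof -
  define F where "F = (\<lambda>t (z :: complex ^ 'n). rec_sol m (\<lambda>k. peval (a k) z) 0 t)"
  have entire: "sep_entire (F t)" for t
    unfolding F_def by (intro sep_entire_rec_sol sep_entire_peval)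
  have \<sigma>: "\<sigma> t = (\<lambda>\<xi>. F t (cvec \<xi>))" if "t \<ge> 0" for t
    unfolding F_def using propagator_symbol_eq[OF assms(5,1) that] by blast
  have F_le: "cmod (F t z) \<le> exp ((C0 * (1 + \<rho>) powr \<nu> + 1) * t)"
    if "t \<ge> 0" "norm (Im_vec z) \<le> \<rho>" for t z \<rho>
    unfolding F_def
  proof (rule rec_sol_bound[OF assms(1) that(1)])
    fix w assume "w ^ m + (\<Sum>k=1..m. peval (a k) z * w ^ (m - k)) = 0"
    \<comment> \<open>With \<open>\<tau> = - \<i> * w\<close> one has
      \<open>Im \<tau> = - Re w\<close>, so the assumed lower bound becomes an upper bound for
      \<open>Re w\<close>.\<close>
    then have "char_symbol m a (\<i> * (- \<i> * w)) z = 0" by (simp add: char_symbol_def)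
    from assms(4)[OF this] have "Re w \<le> C0 * (1 + norm (Im_vec z)) powr \<nu>" by simp
    also have "\<dots> \<le> C0 * (1 + \<rho>) powr \<nu>"
      using assms(2,3) that(2) by (intro mult_left_mono powr_mono2) auto
    finally show "Re w \<le> C0 * (1 + \<rho>) powr \<nu>" .
  qed
  have s: "0 \<le> s" "s \<le> 1" using assms(3,6) by auto
  \<comment> \<open>\<open>CARD('n)\<close> pays for replacing \<open>N ^ N\<close> by the
    factorial, \<open>C0 * 2 powr \<nu>\<close> for the growth in the widened strip, and 1 for the
    \<open>+ 1\<close> in the exponent of \<open>F_le\<close>.\<close>
  define K where "K = real CARD('n) + C0 * 2 powr \<nu> + 1"
  have "cmod (multi_deriv \<alpha> (\<sigma> t) \<xi>)
      \<le> exp K powr ((t + 1) * real (multi_abs \<alpha>) + t) * multi_fact \<alpha> powr s"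
    if t: "t \<ge> 0" for \<xi> t \<alpha>
  proof -
    define N where "N = multi_abs \<alpha>"
    define js where "js = (SOME js. \<forall>j. count_list js j = \<alpha> j)"
    have "\<forall>j. count_list js j = \<alpha> j"
      unfolding js_def using ex_count_list_eq by (rule someI_ex)
    then have length_js: "length js = N"
      unfolding N_def multi_abs_def using sum_count_set[of js UNIV] by simp
    have multi: "multi_deriv \<alpha> (\<sigma> t) \<xi> = foldr cpartial js (F t) (cvec \<xi>)"
      unfolding multi_deriv_def js_def[symmetric] \<sigma>[OF t] iter_partial_cvec[OF entire] ..
    have fact_pos: "multi_fact \<alpha> > 0" by (simp add: multi_fact_def prod_pos)
    show ?thesis
    \<comment> \<open>For \<open>N = 0\<close> the radius below would be 0, since
      \<open>0 powr x = 0\<close>; the bound on the real space is then used directly.\<close>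
    proof (cases "N = 0")
      case True
      then have "\<And>j. \<alpha> j = 0" by (simp add: N_def multi_abs_def)
      then have "multi_fact \<alpha> = 1" by (simp add: multi_fact_def)
      moreover have "cmod (F t (cvec \<xi>)) \<le> exp (K * t)"
      proof -
        have "1 powr \<nu> \<le> 2 powr \<nu>" using assms(3) by (intro powr_mono2) auto
        then have "C0 * 1 \<le> C0 * 2 powr \<nu>" using assms(2) by (intro mult_left_mono) auto
        then have "(C0 * (1 + 0) powr \<nu> + 1) * t \<le> K * t"
          unfolding K_def using t by (intro mult_right_mono) auto
        then show ?thesis using F_le[OF t, of "cvec \<xi>" 0] by (simp add: order_trans)
      qed
      ultimately show ?thesis
        using True length_js multi by (simp add: N_def powr_def mult.commute)
    next
      case False
      then have N: "real N \<ge> 1" by simp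
      \<comment> \<open>Then \<open>N * r = N powr (1 / \<nu>)\<close>, whose power
        \<open>\<nu>\<close> is \<open>N\<close>: the exponential grows only linearly in
        \<open>N\<close>, as the factor \<open>C powr ((t + 1) * N)\<close> allows.\<close>
      define r where "r = real N powr (1 / \<nu> - 1)"
      have r: "r > 0" using N by (simp add: r_def)
      have Nr: "real N * r = real N powr (1 / \<nu>)"
        using N by (simp add: r_def powr_diff)
      have "cmod (foldr cpartial js (F t) (cvec \<xi>)) \<le> exp ((C0 * 2 powr \<nu> * real N + 1) * t) / r ^ length js"
      proof (rule cmod_foldr_cpartial_le[OF entire r, where \<rho> = 0])
        fix z :: "complex ^ 'n" assume z: "norm (Im_vec z) \<le> 0 + real (length js) * r"
        \<comment> \<open>Since \<open>N \<ge> 1\<close>, the summand 1 is at most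
          \<open>N powr (1 / \<nu>)\<close>.\<close>
        have "(1 + real N powr (1 / \<nu>)) powr \<nu> \<le> (2 * real N powr (1 / \<nu>)) powr \<nu>"
          using N assms(3) ge_one_powr_ge_zero[of "real N" "1 / \<nu>"] by (intro powr_mono2) auto
        also have "\<dots> = 2 powr \<nu> * real N"
          using N assms(3) by (simp add: powr_mult powr_powr)
        finally have "(C0 * (1 + real N powr (1 / \<nu>)) powr \<nu> + 1) * t \<le> (C0 * 2 powr \<nu> * real N + 1) * t"
          using assms(2) t by (intro mult_right_mono) auto
        then show "cmod (F t z) \<le> exp ((C0 * 2 powr \<nu> * real N + 1) * t)"
          using F_le[OF t, of z "real N powr (1 / \<nu>)"] z by (simp add: length_js Nr order_trans)
      qed simp
      also have "\<dots> = (real N ^ N) powr s * exp ((C0 * 2 powr \<nu> * real N + 1) * t)"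
      proof -
        \<comment> \<open>The exponent of \<open>r\<close> is \<open>1 / \<nu> - 1 = - s\<close>;
          this is where the Gevrey order arises.\<close>
        have "r ^ N = real N powr (- s * real N)"
          using N by (simp add: r_def assms(6) powr_powr flip: powr_realpow)
        moreover have "(real N ^ N) powr s = real N powr (s * real N)"
          using N by (simp add: powr_powr mult.commute flip: powr_realpow)
        ultimately show ?thesis
          by (simp add: length_js powr_minus field_simps)
      qed
      also have "(real N ^ N) powr s \<le> (exp (real CARD('n) * real N) * multi_fact \<alpha>) powr s"
        using multi_abs_power_le[of \<alpha>] s by (intro powr_mono2) (auto simp: N_def)
      also have "\<dots> = exp (real CARD('n) * real N * s) * multi_fact \<alpha> powr s"
        using fact_pos by (simp add: powr_mult exp_powr_real)
      also have "exp (real CARD('n) * real N * s) * multi_fact \<alpha> powr s *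
          exp ((C0 * 2 powr \<nu> * real N + 1) * t) =
          exp (real CARD('n) * real N * s + (C0 * 2 powr \<nu> * real N + 1) * t) * multi_fact \<alpha> powr s"
        by (simp add: exp_add)
      also have "\<dots> \<le> exp (K * ((t + 1) * real N + t)) * multi_fact \<alpha> powr s"
      proof (intro mult_right_mono)
        have "real CARD('n) * real N * s \<le> real CARD('n) * real N"
          using s N by (intro mult_left_le) auto
        \<comment> \<open>The right-hand side is \<open>K * ((t + 1) * N + t)\<close> minus
          \<open>CARD('n) * N + (C0 * 2 powr \<nu> * N + 1) * t\<close>, expanded.\<close>
        moreover have "0 \<le> real CARD('n) * (t * real N + t) + C0 * 2 powr \<nu> * (real N + t) + (t + 1) * real N"
          using t assms(2) by (intro add_nonneg_nonneg mult_nonneg_nonneg) auto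
        ultimately show "exp (real CARD('n) * real N * s + (C0 * 2 powr \<nu> * real N + 1) * t)
            \<le> exp (K * ((t + 1) * real N + t))"
          by (simp add: K_def algebra_simps)
      qed simp
      finally show ?thesis
        by (simp add: multi N_def powr_def mult.commute)
    qed
  qed
  moreover have "exp K > 0" by simp
  ultimately show ?thesis
    using \<sigma> smooth_fun_cvec[OF entire] by (intro conjI exI[of _ "exp K"]) auto
qed

end
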